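(* Let $N \ge 2$ and $\alpha \in (0,1)$. Let $P$ be the transfer operator of the discrete cat map $T_N$ on $X_N=(\mathbb{Z}/N\mathbb{Z})^2$ and let $G_N = (I-\alpha P)^{-1}$. Then for every $x \in X_N$ the diagonal landscape $\widetilde{u}_N(x) = G_N(x,x)$ satisfies $$\widetilde{u}_N(x) = \frac{1}{1-\alpha^{k_x}},$$ where $k_x$ is the minimal period of $x$ under $T_N$.
   Context: $X_N=(\mathbb{Z}/N\mathbb{Z})^2$, $A=\begin{pmatrix}1&1\\1&2\end{pmatrix}$, and $T_N(x)=Ax \bmod N$ (the discrete cat map, a bijection of $X_N$). The minimal period $k_x$ is the least $k\ge 1$ with $T_N^k(x)=x$. The transfer operator acts on functions $f:X_N\to\mathbb{C}$ by $(Pf)(x)=f(A^{-1}x \bmod N)$. Operators on functions on $X_N$ are identified with matrices indexed by $X_N\times X_N$; $G_N(x,y)$ is the $(x,y)$ entry. *)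

theory Defs
  imports "HOL-Analysis.Analysis" "Berlekamp_Zassenhaus.Finite_Field"
begin

text \<open>
  The modulus is \<open>N = CARD('n)\<close>, and \<open>'n mod_ring\<close> is the ring of integers modulo \<open>N\<close>.
  The sort constraint \<open>'n :: nontriv\<close> says exactly \<open>CARD('n) > 1\<close>, that is, \<open>N \<ge> 2\<close>.
  Arithmetic in \<open>'n mod_ring\<close> is modulo \<open>N\<close>, so no explicit reduction appears below.
\<close>

type_synonym 'n torus = "'n mod_ring ^ 2"

definition cat_matrix :: "'n::nontriv mod_ring ^ 2 ^ 2" where
  "cat_matrix = vector [vector [1, 1], vector [1, 2]]"

definition cat_map :: "'n::nontriv torus \<Rightarrow> 'n torus" where
  "cat_map x = cat_matrix *v x"

definition min_period :: "'n::nontriv torus \<Rightarrow> nat" where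
  "min_period x = (LEAST k. 1 \<le> k \<and> (cat_map ^^ k) x = x)"

text \<open>
  Complex-valued functions on the finite set \<open>X\<^sub>N\<close> are vectors indexed by the type
  \<open>'n torus\<close>; \<open>matrix\<close> turns a linear operator on them into its matrix, whose
  \<open>(x, y)\<close> entry is \<open>M $ x $ y\<close>.
\<close>

definition transfer_op :: "complex ^ ('n::nontriv torus) \<Rightarrow> complex ^ ('n torus)" where
  "transfer_op f = (\<chi> x. f $ (matrix_inv cat_matrix *v x))"

definition one_minus_transfer :: "real \<Rightarrow> complex ^ ('n::nontriv torus) ^ ('n torus)" where
  "one_minus_transfer \<alpha> = mat 1 - \<alpha> *\<^sub>R matrix transfer_op"

definition green :: "real \<Rightarrow> complex ^ ('n::nontriv torus) ^ ('n torus)" where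
  "green \<alpha> = matrix_inv (one_minus_transfer \<alpha>)"

definition diag_landscape :: "real \<Rightarrow> 'n::nontriv torus \<Rightarrow> complex" where
  "diag_landscape \<alpha> x = green \<alpha> $ x $ x"

end

theory Submission
  imports Defs
begin

text \<open>
  The equation \<open>(I - \<alpha> P) G = I\<close> says that each column \<open>g = G(\<cdot>, x)\<close> satisfies
  \<open>g(T y) = [T y = x] + \<alpha> g(y)\<close>. Following \<open>g\<close> along the orbit of \<open>x\<close>, the inhomogeneous
  term appears only at the return time \<open>k\<close>, so \<open>g(x) = 1 + \<alpha>\<^sup>k g(x)\<close>. The homogeneous
  version of the same argument shows that \<open>I - \<alpha> P\<close> has trivial kernel.
\<close>

lemma inj_funpow_returns:
  fixes f :: "'a::finite \<Rightarrow> 'a"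
  assumes "inj f"
  shows "\<exists>k\<ge>1. (f ^^ k) x = x"
proof -
  obtain k where "k > 0" "(f ^^ k) x = x"
    using funpow_inj_finite[OF assms, of x] by auto
  then show ?thesis by (intro exI[of _ k]) auto
qed

lemma invertible_cat_matrix: "invertible (cat_matrix :: 'n::nontriv mod_ring ^ 2 ^ 2)"
proof -
  \<comment> \<open>The adjugate of \<open>cat_matrix\<close>: the determinant is 1, so it is an
    inverse modulo every N.\<close>
  define B :: "'n mod_ring ^ 2 ^ 2" where "B = vector [vector [2, -1], vector [-1, 1]]"
  have "cat_matrix ** B = mat 1" "B ** cat_matrix = mat 1"
    by (simp_all add: cat_matrix_def B_def matrix_matrix_mult_def mat_def vec_eq_iff
        forall_2 sum_2)
  then show ?thesis unfolding invertible_def by blast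
qed

lemma matrix_inv_cat_matrix_cat_map [simp]:
  fixes x :: "'n::nontriv torus"
  shows "matrix_inv cat_matrix *v cat_map x = x"
proof -
  have "matrix_inv cat_matrix ** cat_matrix = (mat 1 :: 'n mod_ring ^ 2 ^ 2)"
    \<comment> \<open>\<open>matrix_inv\<close> is a Hilbert choice; invertibility guarantees that
      the chosen matrix really is an inverse.\<close>
    using someI_ex[OF invertible_cat_matrix[unfolded invertible_def]]
    unfolding matrix_inv_def by blast
  then show ?thesis
    by (simp add: cat_map_def matrix_vector_mul_assoc)
qed

lemma inj_cat_map: "inj cat_map"
  by (rule inj_on_inverseI[where g = "\<lambda>x. matrix_inv cat_matrix *v x"]) simp

text \<open>Injectivity on a finite set closes every orbit into a cycle, so the \<open>LEAST\<close>
  in \<open>min_period\<close> ranges over a nonempty set.\<close>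

lemma
  fixes x :: "'n::nontriv torus"
  shows min_period_pos: "1 \<le> min_period x"
    and funpow_min_period: "(cat_map ^^ min_period x) x = x"
    and funpow_less_min_period: "0 < j \<Longrightarrow> j < min_period x \<Longrightarrow> (cat_map ^^ j) x \<noteq> x"
proof -
  have "\<exists>k. 1 \<le> k \<and> (cat_map ^^ k) x = x"
    using inj_funpow_returns[OF inj_cat_map] by blast
  then have "1 \<le> min_period x \<and> (cat_map ^^ min_period x) x = x"
    unfolding min_period_def by (rule LeastI_ex)
  then show "1 \<le> min_period x" "(cat_map ^^ min_period x) x = x" by auto
  show "(cat_map ^^ j) x \<noteq> x" if "0 < j" "j < min_period x"
    using not_less_Least[OF that(2)[unfolded min_period_def]] that(1) by auto
qed

text \<open>Evaluating at \<open>cat_map y\<close> instead of \<open>y\<close> cancels the inverse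
  matrix inside \<open>transfer_op\<close> and leaves a forward recurrence along orbits.\<close>

lemma one_minus_transfer_mult_cat_map:
  fixes v :: "complex ^ ('n::nontriv torus)"
  shows "(one_minus_transfer \<alpha> *v v) $ cat_map y = v $ cat_map y - of_real \<alpha> * v $ y"
proof -
  have lin: "Vector_Spaces.linear (*s) (*s) (transfer_op :: complex ^ 'n torus \<Rightarrow> _)"
    by unfold_locales (simp_all add: transfer_op_def vec_eq_iff algebra_simps)
  have "(\<alpha> *\<^sub>R matrix transfer_op *v v) = \<alpha> *\<^sub>R (matrix transfer_op *v v)"
    by (simp add: vec_eq_iff matrix_vector_mult_def scaleR_sum_right)
  also have "matrix transfer_op *v v = transfer_op v"
    using lin by (rule matrix_works)
  finally have "one_minus_transfer \<alpha> *v v = v - \<alpha> *\<^sub>R transfer_op v"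
    by (simp add: one_minus_transfer_def matrix_vector_mult_diff_rdistrib)
  then show ?thesis
    by (simp add: transfer_op_def scaleR_conv_of_real[where 'a = complex])
qed

text \<open>The recurrence is assumed only for the first \<open>j\<close> steps, so that it covers
  both a full period (kernel) and a period less its last step (Green matrix).\<close>

lemma funpow_orbit_scale:
  fixes g :: "'a \<Rightarrow> complex"
  assumes "\<And>i. Suc i \<le> j \<Longrightarrow> g ((f ^^ Suc i) x) = c * g ((f ^^ i) x)"
  shows "g ((f ^^ j) x) = c ^ j * g x"
  using assms
proof (induction j)
  case (Suc j)
  then show ?case using Suc.prems[of j] by simp
qed simp

lemma of_real_power_neq_1:
  assumes "0 < \<alpha>" "\<alpha> < 1" "1 \<le> k"
  shows "complex_of_real \<alpha> ^ k \<noteq> 1"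
proof -
  have "\<alpha> ^ k < 1" using assms by (simp add: power_less_one_iff)
  then show ?thesis
    by (metis less_irrefl of_real_eq_1_iff of_real_power)
qed

lemma invertible_one_minus_transfer:
  assumes "0 < \<alpha>" "\<alpha> < 1"
  shows "invertible (one_minus_transfer \<alpha> :: complex ^ ('n::nontriv torus) ^ ('n torus))"
proof -
  \<comment> \<open>For a square matrix a left inverse suffices, and it exists exactly when the
    kernel is trivial.\<close>
  have "v = 0" if v: "one_minus_transfer \<alpha> *v v = 0" for v :: "complex ^ 'n torus"
  proof -
    have "v $ x = 0" for x
    proof -
      have "v $ cat_map y = of_real \<alpha> * v $ y" for y
        using one_minus_transfer_mult_cat_map[of \<alpha> v y] v by simp
      \<comment> \<open>After one full turn the left side is \<open>v $ x\<close> again, while the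
        factor on the right differs from 1.\<close>
      then have "v $ (cat_map ^^ min_period x) x = of_real \<alpha> ^ min_period x * v $ x"
        by (intro funpow_orbit_scale) simp
      then show ?thesis
        using of_real_power_neq_1[OF assms min_period_pos[of x]]
        by (simp add: funpow_min_period)
    qed
    then show ?thesis by (simp add: vec_eq_iff)
  qed
  then show ?thesis
    unfolding invertible_left_inverse matrix_left_invertible_ker by blast
qed

lemma green_cat_map:
  fixes x y :: "'n::nontriv torus"
  assumes "0 < \<alpha>" "\<alpha> < 1"
  shows "green \<alpha> $ cat_map y $ x = (if cat_map y = x then 1 else 0) + of_real \<alpha> * green \<alpha> $ y $ x"
proof -
  have "one_minus_transfer \<alpha> ** green \<alpha> = (mat 1 :: complex ^ 'n torus ^ 'n torus)"
    using someI_ex[OF invertible_one_minus_transfer[OF assms, unfolded invertible_def]]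
    unfolding green_def matrix_inv_def by blast
  then have "one_minus_transfer \<alpha> *v column x (green \<alpha>) = column x (mat 1)"
    by (simp add: vec_eq_iff column_def matrix_matrix_mult_def matrix_vector_mult_def)
  then show ?thesis
    using one_minus_transfer_mult_cat_map[of \<alpha> "column x (green \<alpha>)" y]
    by (simp add: column_def mat_def algebra_simps split: if_splits)
qed

theorem theorem4p3:
  fixes \<alpha> :: real
  assumes "0 < \<alpha>" and "\<alpha> < 1"
  shows "invertible (one_minus_transfer \<alpha> :: complex ^ ('n::nontriv torus) ^ ('n torus)) \<and>
    (\<forall>x :: 'n torus. diag_landscape \<alpha> x = 1 / (1 - complex_of_real \<alpha> ^ min_period x))"
proof (intro conjI allI)
  show "invertible (one_minus_transfer \<alpha> :: complex ^ ('n torus) ^ ('n torus))"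
    by (rule invertible_one_minus_transfer[OF assms])
next
  fix x :: "'n torus"
  let ?g = "\<lambda>y. green \<alpha> $ y $ x"
  \<comment> \<open>The first \<open>k\<close> steps avoid \<open>x\<close> and only multiply by
    \<alpha>; step \<open>Suc k\<close> lands on \<open>x\<close> and contributes the extra
    1.\<close>
  obtain k where k: "min_period x = Suc k"
    using min_period_pos[of x] by (cases "min_period x") auto
  have "?g ((cat_map ^^ k) x) = of_real \<alpha> ^ k * ?g x"
  proof (rule funpow_orbit_scale)
    fix i assume "Suc i \<le> k"
    then have "(cat_map ^^ Suc i) x \<noteq> x"
      by (intro funpow_less_min_period) (auto simp: k)
    then show "?g ((cat_map ^^ Suc i) x) = of_real \<alpha> * ?g ((cat_map ^^ i) x)"
      using green_cat_map[OF assms, of "(cat_map ^^ i) x" x] by simp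
  qed
  moreover have "cat_map ((cat_map ^^ k) x) = x"
    using funpow_min_period[of x] by (simp add: k)
  ultimately have "?g x = 1 + of_real \<alpha> ^ min_period x * ?g x"
    using green_cat_map[OF assms, of "(cat_map ^^ k) x" x] by (simp add: k mult.assoc)
  \<comment> \<open>This makes the denominator nonzero, so the linear equation for
    \<open>?g x\<close> can be solved.\<close>
  moreover have "complex_of_real \<alpha> ^ min_period x \<noteq> 1"
    using assms min_period_pos by (rule of_real_power_neq_1)
  ultimately show "diag_landscape \<alpha> x = 1 / (1 - complex_of_real \<alpha> ^ min_period x)"
    by (simp add: diag_landscape_def field_simps)
qed

end
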